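(* There exists a constant $\delta>0$ such that $$\frac{5}{13}\le \gamma_{1,1,-3}\le \frac12-\delta .$$
   Context: For integers $a,b,c$ and a finite set $S\subset\mathbb{Z}$, let $T_{a,b,c}(S)=\#\{(x,y,z)\in S^3: ax+by+cz=0\}$, and let $$\gamma_{a,b,c}=\limsup_{|S|\to+\infty}\frac{T_{a,b,c}(S)}{|S|^2},$$ where the limsup is over finite sets $S\subset \mathbb{Z}$ (i.e. $\gamma_{a,b,c}=\limsup_{N\to\infty}\max_{|S|=N}T_{a,b,c}(S)/N^2$). *)

theory Defs
  imports "HOL-Analysis.Analysis"
begin

definition solution_count :: "int \<Rightarrow> int \<Rightarrow> int \<Rightarrow> int set \<Rightarrow> nat" where
  "solution_count a b c S =
     card {(x, y, z). x \<in> S \<and> y \<in> S \<and> z \<in> S \<and> a * x + b * y + c * z = 0}"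

text \<open>
  The limsup is taken in the extended reals, so that it is meaningful for all coefficients
  (for a = b = c = 0 it is infinite). The inner supremum is the maximum over all S with N elements:
  it is attained, because the count is a natural number bounded by N ^ 3. The term N = 0, where the
  quotient is 0 / 0 = 0, does not affect the limsup.
\<close>

definition solution_density :: "int \<Rightarrow> int \<Rightarrow> int \<Rightarrow> ereal" where
  "solution_density a b c =
     limsup (\<lambda>N::nat. SUP S \<in> {S :: int set. finite S \<and> card S = N}.
       ereal (real (solution_count a b c S) / real N ^ 2))"

end

theory Submission
  imports Defs "HOL-Real_Asymp.Real_Asymp"
begin

text \<open>
  Upper bound. Discard 0 from S. Multiplying S by 3 does not change the number of solutions, so assume that S is not
  contained in the multiples of 3, and split it into its k non-multiples A and its n multiples B of 3.
  Besides the solutions inside B there are those with x, y in A, at most k^2 / 2 since x and y lie in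
  opposite classes, and those with z in A and x, y in B, at most n k. Induction gives N^2 / 2.

  To save a constant factor: if neither k nor n is negligible, few of the pairs from B have their sum
  in 3A, because sumsets are large. If n is negligible, splitting A modulo 9 shows that either many
  pairs of opposite classes sum to a multiple of 9, or the classes are concentrated enough for the
  sumset bound to apply. If k is negligible, note that one of x, y must be divisible by 3 only once;
  so either B has few such elements and the induction step gains, or they are a positive
  proportion of B and the previous cases apply to B / 3.

  Lower bound. The sets [-6m, 6m] together with 3 [-9m, 9m] have 26m + 1 elements and about
  260 m^2 solutions.
\<close>

subsection \<open>Pairs with sum in a prescribed set\<close>

text \<open>\<open>C\<close> is always 3 times a set of candidates for z, so a pair (x, y) stands
  for a solution whose z is determined. Keeping the three sets separate allows each type of solution
  to be bounded by itself.\<close>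

definition reps :: "int set \<Rightarrow> int set \<Rightarrow> int set \<Rightarrow> nat" where
  "reps A B C = card {(x, y). x \<in> A \<and> y \<in> B \<and> x + y \<in> C}"

abbreviation sols :: "int set \<Rightarrow> nat" where
  "sols S \<equiv> reps S S ((*) 3 ` S)"

lemma solution_count_eq_sols: "solution_count 1 1 (-3) S = sols S"
proof -
  have "bij_betw (\<lambda>(x, y, z). (x, y))
      {(x, y, z). x \<in> S \<and> y \<in> S \<and> z \<in> S \<and> 1 * x + 1 * y + (-3) * z = 0}
      {(x, y). x \<in> S \<and> y \<in> S \<and> x + y \<in> (*) 3 ` S}"
    by (rule bij_betw_byWitness[where f' = "\<lambda>(x, y). (x, y, (x + y) div 3)"]) auto
  then show ?thesis
    unfolding solution_count_def reps_def by (rule bij_betw_same_card)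
qed

lemma finite_reps_set:
  fixes A B :: "int set"
  assumes "finite A" "finite B"
  shows "finite {(x, y). x \<in> A \<and> y \<in> B \<and> P x y}"
  by (rule finite_subset[of _ "A \<times> B"]) (use assms in auto)

lemma reps_le_prod:
  assumes "finite A" "finite B"
  shows "reps A B C \<le> card A * card B"
proof -
  have "reps A B C \<le> card (A \<times> B)"
    unfolding reps_def by (rule card_mono) (use assms in auto)
  then show ?thesis by (simp add: card_cartesian_product)
qed

text \<open>A pair is determined by x together with x + y.\<close>

lemma reps_le_prod_left:
  assumes "finite A" "finite C"
  shows "reps A B C \<le> card A * card C"
proof -
  have "reps A B C \<le> card (A \<times> C)"
    unfolding reps_def
    by (rule card_inj_on_le[where f = "\<lambda>(x, y). (x, x + y)"]) (use assms in \<open>auto simp: inj_on_def\<close>)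
  then show ?thesis by (simp add: card_cartesian_product)
qed

lemma reps_commute: "reps A B C = reps B A C"
  unfolding reps_def
  by (rule bij_betw_same_card[where f = prod.swap], rule bij_betw_byWitness[where f' = prod.swap])
     (auto simp: add.commute)

lemma reps_le_prod_right:
  assumes "finite B" "finite C"
  shows "reps A B C \<le> card B * card C"
  using reps_le_prod_left[OF assms] reps_commute by simp

text \<open>A solution outside \<open>S'\<close> has x, y or z in \<open>S - S'\<close>; that
  coordinate and one other determine it. This makes it possible to discard a negligible part of
  \<open>S\<close>.\<close>

lemma sols_le_subset:
  assumes "finite S" "S' \<subseteq> S"
  shows "sols S \<le> sols S' + 3 * card (S - S') * card S"
proof -
  define D where "D = S - S'"
  have fin: "finite D" "finite S'" using assms finite_subset by (auto simp: D_def)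
  have "{(x, y). x \<in> S \<and> y \<in> S \<and> x + y \<in> (*) 3 ` S} \<subseteq>
      ({(x, y). x \<in> S' \<and> y \<in> S' \<and> x + y \<in> (*) 3 ` S'}
       \<union> {(x, y). x \<in> S \<and> y \<in> S \<and> x + y \<in> (*) 3 ` D}) \<union> (D \<times> S \<union> S \<times> D)"
    by (auto simp: D_def)
  then have "sols S \<le> card (({(x, y). x \<in> S' \<and> y \<in> S' \<and> x + y \<in> (*) 3 ` S'}
       \<union> {(x, y). x \<in> S \<and> y \<in> S \<and> x + y \<in> (*) 3 ` D}) \<union> (D \<times> S \<union> S \<times> D))"
    unfolding reps_def by (rule card_mono[rotated]) (use assms fin in \<open>auto intro: finite_reps_set\<close>)
  also have "\<dots> \<le> (reps S' S' ((*) 3 ` S') + reps S S ((*) 3 ` D)) + (card D * card S + card S * card D)"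
    unfolding reps_def
    by (intro order.trans[OF card_Un_le] add_mono) (auto simp: card_cartesian_product)
  also have "reps S S ((*) 3 ` D) \<le> card S * card D"
    using reps_le_prod_left[of S "(*) 3 ` D" S] assms fin
    by (simp add: card_image inj_on_def)
  finally show ?thesis by (simp add: D_def algebra_simps)
qed

lemma card_image_times_3: "card ((*) 3 ` S) = card (S :: int set)"
  by (simp add: card_image inj_on_def)

lemma sols_image_times_3:
  "sols ((*) 3 ` S) = sols S"
proof -
  have "3 * x + 3 * y = 9 * z \<longleftrightarrow> x + y = 3 * z" for x y z :: int
    by presburger
  then have "bij_betw (\<lambda>(x, y). (3 * x, 3 * y))
     {(x, y). x \<in> S \<and> y \<in> S \<and> x + y \<in> (*) 3 ` S}
     {(x, y). x \<in> (*) 3 ` S \<and> y \<in> (*) 3 ` S \<and> x + y \<in> (*) 3 ` (*) 3 ` S}"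
    by (intro bij_betw_byWitness[where f' = "\<lambda>(x, y). (x div 3, y div 3)"]) (auto simp: image_iff)
  then show ?thesis unfolding reps_def by (rule bij_betw_same_card[symmetric])
qed

text \<open>Peel off the pairs containing the minimum of A or the maximum of B: they form a chain on
  which the sum is injective, so at most card C of these a + b - 1 pairs have their sum in C.\<close>

lemma nonreps_lower_bound:
  fixes A B C :: "int set"
  assumes "finite A" "finite B" "finite C" "card C \<le> K"
    and "card A \<le> card B + K + 1" "card B \<le> card A + K + 1" "K \<le> card A + card B + 1"
  shows "(int (card A) + int (card B) - int K)\<^sup>2
    \<le> 1 + 4 * int (card {(x, y). x \<in> A \<and> y \<in> B \<and> x + y \<notin> C})"
  using assms
proof (induction "card A" arbitrary: A B rule: less_induct)
  case less
  define s where "s = int (card A) + int (card B) - int K"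
  show ?case
  \<comment> \<open>These are the cases where the size hypotheses force \<open>s\<close> into
    [-1, 1]: the last one gives s \<ge> -1, and if \<open>A\<close> or \<open>B\<close> is empty one
    of the other two gives s \<le> 1.\<close>
  proof (cases "s \<le> 1 \<or> A = {} \<or> B = {}")
    case True
    then have "\<bar>s\<bar> \<le> 1" using less.prems by (auto simp: s_def)
    then have "s\<^sup>2 \<le> 1" by (simp add: abs_square_le_1)
    then show ?thesis by (simp add: s_def)
  next
    case False
    define m where "m = Min A"
    define M where "M = Max B"
    have m: "m \<in> A" "\<And>x. x \<in> A \<Longrightarrow> m \<le> x" and M: "M \<in> B" "\<And>x. x \<in> B \<Longrightarrow> x \<le> M"
      using False less.prems by (auto simp: m_def M_def)
    define H where "H = {m} \<times> B \<union> (A - {m}) \<times> {M}"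
    have finH: "finite H" using less.prems by (simp add: H_def)
    have a1: "card (A - {m}) = card A - 1" and b1: "card (B - {M}) = card B - 1"
      and pos: "card A > 0" "card B > 0"
      using m M less.prems by (auto simp: card_gt_0_iff)
    have cH: "int (card H) = int (card A) + int (card B) - 1"
      unfolding H_def using less.prems a1 pos
      by (subst card_Un_disjoint) (auto simp: card_cartesian_product)
    \<comment> \<open>Sums from {m} x \<open>B\<close> are at most m + M, the remaining ones exceed
      m + M, and on each piece one summand is fixed.\<close>
    have inj: "inj_on (\<lambda>(x, y). x + y) H"
      unfolding inj_on_def H_def using m M by (auto; smt (verit))
    have "card {p \<in> H. fst p + snd p \<in> C} \<le> card C"
      by (rule card_inj_on_le[where f = "\<lambda>(x, y). x + y"])
         (use less.prems(3) in \<open>auto intro: inj_on_subset[OF inj]\<close>)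
    moreover have "card H = card {p \<in> H. fst p + snd p \<in> C} + card {p \<in> H. fst p + snd p \<notin> C}"
    proof -
      have "H = {p \<in> H. fst p + snd p \<in> C} \<union> {p \<in> H. fst p + snd p \<notin> C}" by blast
      moreover have "{p \<in> H. fst p + snd p \<in> C} \<inter> {p \<in> H. fst p + snd p \<notin> C} = {}" by blast
      ultimately show ?thesis using finH
        by (metis (no_types, lifting) card_Un_disjoint finite_Un)
    qed
    ultimately have badH: "int (card {p \<in> H. fst p + snd p \<notin> C}) \<ge> s - 1"
      using cH less.prems(4) by (simp add: s_def)
    let ?R = "{(x, y). x \<in> A - {m} \<and> y \<in> B - {M} \<and> x + y \<notin> C}"
    have IH: "(s - 2)\<^sup>2 \<le> 1 + 4 * int (card ?R)"
    proof -
      have "(int (card (A - {m})) + int (card (B - {M})) - int K)\<^sup>2 \<le> 1 + 4 * int (card ?R)"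
        using False less.prems pos a1 b1
        by (intro less.hyps) (auto simp: s_def)
      then show ?thesis using a1 b1 pos by (simp add: s_def of_nat_diff algebra_simps)
    qed
    have "{(x, y). x \<in> A \<and> y \<in> B \<and> x + y \<notin> C} = {p \<in> H. fst p + snd p \<notin> C} \<union> ?R"
      using m M by (auto simp: H_def)
    moreover have "{p \<in> H. fst p + snd p \<notin> C} \<inter> ?R = {}"
      by (auto simp: H_def)
    moreover have "finite ?R" by (rule finite_reps_set) (use less.prems in auto)
    ultimately have "card {(x, y). x \<in> A \<and> y \<in> B \<and> x + y \<notin> C}
        = card {p \<in> H. fst p + snd p \<notin> C} + card ?R"
      using finH by (simp only: card_Un_disjoint finite_Collect_conjI Collect_mem_eq simp_thms)
    \<comment> \<open>Peeling lowers \<open>s\<close> by 2 and contributes at least s - 1 bad pairs,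
      which is exactly the increment that this identity requires.\<close>
    moreover have "s\<^sup>2 = (s - 2)\<^sup>2 + 4 * (s - 1)" by (simp add: power2_eq_square algebra_simps)
    ultimately show ?thesis using IH badH by (simp add: s_def)
  qed
qed

lemma reps_plus_nonreps:
  assumes "finite A" "finite B"
  shows "reps A B C + card {(x, y). x \<in> A \<and> y \<in> B \<and> x + y \<notin> C} = card A * card B"
proof -
  have "{(x, y). x \<in> A \<and> y \<in> B \<and> x + y \<in> C} \<union> {(x, y). x \<in> A \<and> y \<in> B \<and> x + y \<notin> C} = A \<times> B"
    by auto
  then show ?thesis
    unfolding reps_def using assms
    by (subst card_Un_disjoint[symmetric]) (auto simp: card_cartesian_product finite_reps_set)
qed

subsection \<open>Sets without multiples of 3\<close>

text \<open>Two non-multiples of 3 whose sum is a multiple of 3 lie in opposite classes, and both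
  orders occur equally often.\<close>

lemma reps_nonmultiples:
  assumes "finite S" "\<And>x. x \<in> S \<Longrightarrow> \<not> 3 dvd x"
  shows "reps S S ((*) 3 ` T) = 2 * reps {x \<in> S. x mod 3 = 1} {x \<in> S. x mod 3 = 2} ((*) 3 ` T)"
proof -
  define A B where "A = {x \<in> S. x mod 3 = 1}" and "B = {x \<in> S. x mod 3 = 2}"
  have fin: "finite A" "finite B" using assms by (auto simp: A_def B_def)
  have "(x \<in> A \<and> y \<in> B) \<or> (x \<in> B \<and> y \<in> A)"
    if "x \<in> S" "y \<in> S" "x + y \<in> (*) 3 ` T" for x y
  proof -
    have "3 dvd x + y" using that by auto
    moreover have "\<not> 3 dvd x" "\<not> 3 dvd y" using that assms by auto
    ultimately have "x mod 3 = 1 \<and> y mod 3 = 2 \<or> x mod 3 = 2 \<and> y mod 3 = 1" by presburger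
    then show ?thesis using that by (auto simp: A_def B_def)
  qed
  then have "{(x, y). x \<in> S \<and> y \<in> S \<and> x + y \<in> (*) 3 ` T} =
      {(x, y). x \<in> A \<and> y \<in> B \<and> x + y \<in> (*) 3 ` T} \<union> {(x, y). x \<in> B \<and> y \<in> A \<and> x + y \<in> (*) 3 ` T}"
    by (auto simp: A_def B_def)
  also have "card \<dots> = reps A B ((*) 3 ` T) + reps B A ((*) 3 ` T)"
    unfolding reps_def
    by (rule card_Un_disjoint[OF finite_reps_set[OF fin] finite_reps_set[OF fin(2,1)]])
       (auto simp: A_def B_def)
  finally show ?thesis
    using reps_commute[of B A] by (simp add: reps_def A_def B_def)
qed

lemma card_nonmultiples:
  assumes "finite S" "\<And>x. x \<in> S \<Longrightarrow> \<not> 3 dvd x"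
  shows "card S = card {x \<in> S. x mod 3 = 1} + card {x \<in> S. x mod 3 = (2 :: int)}"
proof -
  have "x mod 3 = 1 \<or> x mod 3 = 2" if "x \<in> S" for x
    using assms(2)[OF that] by presburger
  then have "S = {x \<in> S. x mod 3 = 1} \<union> {x \<in> S. x mod 3 = 2}" by auto
  then show ?thesis
    using assms(1) by (subst card_Un_disjoint[symmetric]) auto
qed

text \<open>With class sizes a and b the count is at most 2ab, and 4ab \<le> (a + b)^2.\<close>

lemma reps_nonmultiples_le:
  assumes "finite S" "\<And>x. x \<in> S \<Longrightarrow> \<not> 3 dvd x"
  shows "real (reps S S ((*) 3 ` T)) \<le> real (card S) ^ 2 / 2"
proof -
  define a b where "a = card {x \<in> S. x mod 3 = 1}" and "b = card {x \<in> S. x mod 3 = 2}"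
  have "reps S S ((*) 3 ` T) \<le> 2 * (a * b)"
    using reps_nonmultiples[OF assms, of T]
      reps_le_prod[of "{x \<in> S. x mod 3 = 1}" "{x \<in> S. x mod 3 = 2}"] assms(1)
    by (simp add: a_def b_def)
  then have "real (reps S S ((*) 3 ` T)) \<le> 2 * (real a * real b)"
    by (metis of_nat_mono of_nat_mult of_nat_numeral)
  also have "\<dots> \<le> (real a + real b) ^ 2 / 2"
    using zero_le_power2[of "real a - real b"] by (simp add: power2_eq_square algebra_simps)
  finally show ?thesis
    using card_nonmultiples[OF assms] by (simp add: a_def b_def)
qed

text \<open>If no product u_i r_i is large, then u and r have no common heavy index, so one of them is
  concentrated on a single index, which the other one then nearly avoids.\<close>

lemma concentration:
  fixes u0 u1 u2 r0 r1 r2 a b \<beta> :: real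
  assumes "u0 \<ge> 0" "u1 \<ge> 0" "u2 \<ge> 0" "r0 \<ge> 0" "r1 \<ge> 0" "r2 \<ge> 0"
    and "u0 + u1 + u2 = a" "r0 + r1 + r2 = b"
    and "u0 * r0 \<le> \<beta>" "u1 * r1 \<le> \<beta>" "u2 * r2 \<le> \<beta>" "\<beta> < a * b / 400"
  shows "\<exists>u \<in> {u0, u1, u2}. \<exists>r \<in> {r0, r1, r2}.
    u \<ge> 9 / 10 * a \<and> r \<ge> 9 / 20 * b \<or> u \<ge> 9 / 20 * a \<and> r \<ge> 9 / 10 * b"
proof -
  have light: "u < a / 20 \<or> r < b / 20" if "u * r \<le> \<beta>" "u \<ge> 0" "r \<ge> 0" for u r
  proof (rule ccontr)
    assume "\<not> (u < a / 20 \<or> r < b / 20)"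
    then have "(a / 20) * (b / 20) \<le> u * r"
      using assms by (intro mult_mono) auto
    then show False using that assms(12) by simp
  qed
  let ?u = "\<lambda>c. \<exists>u \<in> {u0, u1, u2}. u \<ge> c * a" and ?r = "\<lambda>c. \<exists>r \<in> {r0, r1, r2}. r \<ge> c * b"
  have L: "u0 < a / 20 \<or> r0 < b / 20" "u1 < a / 20 \<or> r1 < b / 20" "u2 < a / 20 \<or> r2 < b / 20"
    using assms light by auto
  then have some_light: "u0 < a / 20 \<or> u1 < a / 20 \<or> u2 < a / 20" "r0 < b / 20 \<or> r1 < b / 20 \<or> r2 < b / 20"
    using assms(1-8) by linarith+
  \<comment> \<open>If one of the three weights is below 1/20 of the total, the other two share
    19/20, so one of them has at least 19/40.\<close>
  have half: "?u (9 / 20)" "?r (9 / 20)"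
  proof -
    show "?u (9 / 20)"
    proof (rule ccontr)
      assume "\<not> ?u (9 / 20)"
      then have "u0 < 9 / 20 * a" "u1 < 9 / 20 * a" "u2 < 9 / 20 * a" by auto
      with some_light(1) show False by (elim disjE) (use assms(1-8) in linarith)+
    qed
    show "?r (9 / 20)"
    proof (rule ccontr)
      assume "\<not> ?r (9 / 20)"
      then have "r0 < 9 / 20 * b" "r1 < 9 / 20 * b" "r2 < 9 / 20 * b" by auto
      with some_light(2) show False by (elim disjE) (use assms(1-8) in linarith)+
    qed
  qed
  \<comment> \<open>Pigeonhole: each of the three indices is light for u or for r, so two are light
    for the same one, whose third weight is then at least 9/10 of its total.\<close>
  have two_light: "u0 < a / 20 \<and> u1 < a / 20 \<or> u0 < a / 20 \<and> u2 < a / 20 \<or> u1 < a / 20 \<and> u2 < a / 20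
      \<or> r0 < b / 20 \<and> r1 < b / 20 \<or> r0 < b / 20 \<and> r2 < b / 20 \<or> r1 < b / 20 \<and> r2 < b / 20"
    using L by blast
  have "?u (9 / 10) \<or> ?r (9 / 10)"
  proof (rule ccontr)
    assume "\<not> (?u (9 / 10) \<or> ?r (9 / 10))"
    then have "u0 < 9 / 10 * a" "u1 < 9 / 10 * a" "u2 < 9 / 10 * a"
      "r0 < 9 / 10 * b" "r1 < 9 / 10 * b" "r2 < 9 / 10 * b" by auto
    with two_light show False by (elim disjE) (use assms(1-8) in linarith)+
  qed
  then show ?thesis using half by blast
qed

text \<open>Here a and b are the sizes of the two classes and \<beta> is the number of pairs whose
  sum misses the target. Either the classes are unbalanced, and (a - b)^2 / 4 is the saving, or
  \<beta> is at least ab / 400, or the assumption \<open>off\<close> supplies the loss.\<close>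

lemma product_minus_loss_le:
  fixes a b k \<beta> :: real
  assumes nonneg: "a \<ge> 0" "b \<ge> 0" and k: "k = a + b" and \<beta>0: "\<beta> \<ge> 0"
    and off: "\<bar>a - b\<bar> < k / 10 \<Longrightarrow> \<beta> < a * b / 400 \<Longrightarrow> \<beta> \<ge> k\<^sup>2 / 1600 - 1 / 4"
  shows "a * b - \<beta> \<le> k\<^sup>2 / 4 - k\<^sup>2 / 2000 + 1 / 4"
proof -
  have id: "a * b = k\<^sup>2 / 4 - (a - b)\<^sup>2 / 4"
    unfolding k by (simp add: power2_eq_square field_simps)
  have sq: "(a - b)\<^sup>2 \<ge> 0" "k\<^sup>2 \<ge> 0" by simp_all
  consider "\<bar>a - b\<bar> \<ge> k / 10" | "\<bar>a - b\<bar> < k / 10" "\<beta> \<ge> a * b / 400"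
    | "\<bar>a - b\<bar> < k / 10" "\<beta> < a * b / 400" by fastforce
  then show ?thesis
  proof cases
    case 1
    then have "(k / 10)\<^sup>2 \<le> \<bar>a - b\<bar>\<^sup>2" using k nonneg by (intro power_mono) auto
    then have "k\<^sup>2 / 100 \<le> (a - b)\<^sup>2" by (simp add: power_divide)
    then show ?thesis using id \<beta>0 sq by linarith
  next
    case 2
    have "a \<ge> 9 / 20 * k" "b \<ge> 9 / 20 * k" using 2(1) k by linarith+
    then have "(9 / 20 * k) * (9 / 20 * k) \<le> a * b" using k nonneg by (intro mult_mono) auto
    then have "81 / 400 * k\<^sup>2 \<le> a * b" by (simp add: power2_eq_square)
    then have "\<beta> \<ge> k\<^sup>2 / 2000" using 2(2) sq(2) by linarith
    then show ?thesis using id sq by linarith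
  next
    case 3
    then show ?thesis using id sq off by linarith
  qed
qed

text \<open>The count equals 2ab minus twice the number \<beta> of lost pairs, so it suffices to
  find many lost pairs when the classes modulo 3 are balanced. They come from sums divisible by 9
  or, if the residues modulo 9 are concentrated, from the sumset bound.\<close>

lemma sols_nonmultiples_le:
  assumes fin: "finite S" and S: "\<And>x. x \<in> S \<Longrightarrow> \<not> 3 dvd x"
  shows "real (sols S) \<le> (1 / 2 - 1 / 1000) * real (card S) ^ 2 + 1 / 2"
proof -
  define A B where "A = {x \<in> S. x mod 3 = 1}" and "B = {x \<in> S. x mod 3 = 2}"
  define C where "C = (*) 3 ` S"
  define \<beta> where "\<beta> = card {(x, y). x \<in> A \<and> y \<in> B \<and> x + y \<notin> C}"
  define K where "K = max (card A) (card B)"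
  define k a b where "k = real (card S)" and "a = real (card A)" and "b = real (card B)"
  have finAB: "finite A" "finite B" using fin by (auto simp: A_def B_def)
  have k: "k = a + b"
    using card_nonmultiples[OF assms] by (simp add: k_def a_def b_def A_def B_def)
  have "real (sols S) = 2 * real (reps A B C)"
    using reps_nonmultiples[OF assms, of S] by (simp add: A_def B_def C_def)
  moreover have "real (reps A B C) + real \<beta> = a * b"
    using arg_cong[OF reps_plus_nonreps[OF finAB, of C], of real] unfolding \<beta>_def a_def b_def
    by (simp only: of_nat_add of_nat_mult)
  ultimately have sols: "real (sols S) = 2 * (a * b) - 2 * real \<beta>" by simp
  \<comment> \<open>The indices are matched so that \<open>U i\<close> and \<open>W i\<close> have
    opposite residues modulo 9.\<close>
  define U W where "U = (\<lambda>i. {x \<in> S. x mod 9 = 1 + 3 * i})" and "W = (\<lambda>i. {x \<in> S. x mod 9 = 8 - 3 * (i :: int)})"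
  have UA: "U i \<subseteq> A" and WB: "W i \<subseteq> B" for i
  proof -
    show "U i \<subseteq> A"
    proof
      fix x assume "x \<in> U i"
      then have "x \<in> S" "x mod 9 = 1 + 3 * i" by (auto simp: U_def)
      then show "x \<in> A" unfolding A_def by simp presburger
    qed
    show "W i \<subseteq> B"
    proof
      fix x assume "x \<in> W i"
      then have "x \<in> S" "x mod 9 = 8 - 3 * i" by (auto simp: W_def)
      then show "x \<in> B" unfolding B_def by simp presburger
    qed
  qed
  have finU: "finite (U i)" and finW: "finite (W i)" for i using fin by (auto simp: U_def W_def)
  have uK: "card (U i) \<le> K" and wK: "card (W i) \<le> K" for i
    using card_mono[OF finAB(1) UA[of i]] card_mono[OF finAB(2) WB[of i]] by (auto simp: K_def)
  have A_eq: "A = U 0 \<union> U 1 \<union> U 2" and B_eq: "B = W 0 \<union> W 1 \<union> W 2"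
  proof -
    have "x mod 9 = 1 \<or> x mod 9 = 4 \<or> x mod 9 = 7" if "x \<in> A" for x
    proof -
      have "x mod 3 = 1" using that by (simp add: A_def)
      then show ?thesis by presburger
    qed
    then have "A \<subseteq> U 0 \<union> U 1 \<union> U 2" by (auto simp: A_def U_def)
    then show "A = U 0 \<union> U 1 \<union> U 2" using UA by blast
    have "x mod 9 = 8 \<or> x mod 9 = 5 \<or> x mod 9 = 2" if "x \<in> B" for x
    proof -
      have "x mod 3 = 2" using that by (simp add: B_def)
      then show ?thesis by presburger
    qed
    then have "B \<subseteq> W 0 \<union> W 1 \<union> W 2" by (auto simp: B_def W_def)
    then show "B = W 0 \<union> W 1 \<union> W 2" using WB by blast
  qed
  have sumU: "real (card (U 0)) + real (card (U 1)) + real (card (U 2)) = a"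
  proof -
    have "U 0 \<inter> U 1 = {}" "(U 0 \<union> U 1) \<inter> U 2 = {}" by (auto simp: U_def)
    then show ?thesis unfolding a_def A_eq by (simp add: card_Un_disjoint finU)
  qed
  have sumW: "real (card (W 0)) + real (card (W 1)) + real (card (W 2)) = b"
  proof -
    have "W 0 \<inter> W 1 = {}" "(W 0 \<union> W 1) \<inter> W 2 = {}" by (auto simp: W_def)
    then show ?thesis unfolding b_def B_eq by (simp add: card_Un_disjoint finW)
  qed
  have cell: "card {(x, y). x \<in> U i \<and> y \<in> W j \<and> x + y \<notin> C} \<le> \<beta>" for i j
    unfolding \<beta>_def using UA[of i] WB[of j]
    by (intro card_mono finite_reps_set finAB) auto
  have sum_class: "z mod 3 = (i - j) mod 3" if "x \<in> U i" "y \<in> W j" "x + y = 3 * z" for x y z i j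
  proof -
    have "x mod 9 = 1 + 3 * i" "y mod 9 = 8 - 3 * j" using that by (auto simp: U_def W_def)
    then have "x = 9 * (x div 9) + (1 + 3 * i)" "y = 9 * (y div 9) + (8 - 3 * j)"
      using mult_div_mod_eq[of 9 x] mult_div_mod_eq[of 9 y] by simp_all
    then obtain p q where "x = 9 * p + (1 + 3 * i)" "y = 9 * q + (8 - 3 * j)" by blast
    then have "z = i - j + 3 * (p + q + 1)" using that(3) by simp
    then show ?thesis by (simp only: mod_mult_self2)
  qed
  \<comment> \<open>All sums from \<open>U i\<close> and \<open>W i\<close> are multiples of 9,
    hence not 3z with z in \<open>S\<close>; the whole product consists of lost pairs.\<close>
  have diagonal: "real (card (U i)) * real (card (W i)) \<le> real \<beta>" for i
  proof -
    have "x + y \<notin> C" if "x \<in> U i" "y \<in> W i" for x y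
      using sum_class[OF that] S by (auto simp: C_def)
    then have "{(x, y). x \<in> U i \<and> y \<in> W i \<and> x + y \<notin> C} = U i \<times> W i" by auto
    then have "card (U i) * card (W i) \<le> \<beta>"
      using cell[of i i] by (simp add: card_cartesian_product)
    then show ?thesis by (metis of_nat_le_iff of_nat_mult)
  qed
  \<comment> \<open>A third of each sum lies in the fixed class i - j modulo 3, so the effective
    target has at most max a b elements instead of |S|. Only this makes the sumset bound
    effective.\<close>
  have off: "(real (card (U i)) + real (card (W j)) - max a b)\<^sup>2 \<le> 1 + 4 * real \<beta>"
    if "real (card (U i)) + real (card (W j)) \<ge> max a b" for i j
  proof -
    define Z where "Z = {z \<in> S. z mod 3 = (i - j) mod 3}"
    have finZ: "finite Z" using fin by (simp add: Z_def)
    have "(i - j) mod 3 = 0 \<or> (i - j) mod 3 = 1 \<or> (i - j) mod 3 = 2" by presburger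
    then have "Z = {} \<or> Z = A \<or> Z = B"
      using S by (auto simp: Z_def A_def B_def)
    then have "card Z \<le> K" by (auto simp: K_def)
    then have "card ((*) 3 ` Z) \<le> K" by (simp add: card_image inj_on_def)
    moreover have "K \<le> card (U i) + card (W j)"
      using that by (simp add: K_def a_def b_def)
    ultimately have "(int (card (U i)) + int (card (W j)) - int K)\<^sup>2
        \<le> 1 + 4 * int (card {(x, y). x \<in> U i \<and> y \<in> W j \<and> x + y \<notin> (*) 3 ` Z})"
      using uK[of i] wK[of j] finU finW finZ by (intro nonreps_lower_bound) auto
    also have "{(x, y). x \<in> U i \<and> y \<in> W j \<and> x + y \<notin> (*) 3 ` Z}
        = {(x, y). x \<in> U i \<and> y \<in> W j \<and> x + y \<notin> C}"
      using sum_class by (auto simp: C_def Z_def)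
    finally have "(int (card (U i)) + int (card (W j)) - int K)\<^sup>2 \<le> 1 + 4 * int \<beta>"
      using cell[of i j] by linarith
    then have "real_of_int ((int (card (U i)) + int (card (W j)) - int K)\<^sup>2) \<le> real_of_int (1 + 4 * int \<beta>)"
      by (simp only: of_int_le_iff)
    moreover have "real K = max a b" by (simp add: K_def a_def b_def of_nat_max)
    ultimately show ?thesis by simp
  qed
  have nonneg: "a \<ge> 0" "b \<ge> 0" by (auto simp: a_def b_def)
  have "a * b - real \<beta> \<le> k\<^sup>2 / 4 - k\<^sup>2 / 2000 + 1 / 4"
  proof (rule product_minus_loss_le[OF nonneg k])
    show "real \<beta> \<ge> 0" by simp
    assume close: "\<bar>a - b\<bar> < k / 10" and small: "real \<beta> < a * b / 400"
    have "a \<ge> 9 / 20 * k" "b \<ge> 9 / 20 * k" "a \<le> 11 / 20 * k" "b \<le> 11 / 20 * k"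
      using close k by linarith+
    then have ab: "a \<ge> 9 / 20 * k" "b \<ge> 9 / 20 * k" "max a b \<le> 11 / 20 * k"
      by auto
    have "\<exists>u \<in> {real (card (U 0)), real (card (U 1)), real (card (U 2))}.
        \<exists>r \<in> {real (card (W 0)), real (card (W 1)), real (card (W 2))}.
        u \<ge> 9 / 10 * a \<and> r \<ge> 9 / 20 * b \<or> u \<ge> 9 / 20 * a \<and> r \<ge> 9 / 10 * b"
      by (rule concentration[OF _ _ _ _ _ _ sumU sumW diagonal diagonal diagonal small]) simp_all
    then obtain i j where ij: "real (card (U i)) \<ge> 9 / 10 * a \<and> real (card (W j)) \<ge> 9 / 20 * b
        \<or> real (card (U i)) \<ge> 9 / 20 * a \<and> real (card (W j)) \<ge> 9 / 10 * b"
      by blast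
    have k0: "k \<ge> 0" using k nonneg by simp
    \<comment> \<open>The two parts together have at least (9/10 + 9/20) * (9/20) k = 243/400 k
      elements, and max a b is at most 220/400 k.\<close>
    have s: "real (card (U i)) + real (card (W j)) - max a b \<ge> k / 20"
      using ij ab k0 by (elim disjE conjE) linarith+
    then have "(k / 20)\<^sup>2 \<le> (real (card (U i)) + real (card (W j)) - max a b)\<^sup>2"
      using k0 by (intro power_mono) simp_all
    also have "\<dots> \<le> 1 + 4 * real \<beta>"
      by (rule off) (use s k0 in linarith)
    finally show "real \<beta> \<ge> k\<^sup>2 / 1600 - 1 / 4" by (simp add: power_divide)
  qed
  then show ?thesis using sols by (simp add: k_def algebra_simps)
qed

subsection \<open>Peeling off the non-multiples of 3\<close>

text \<open>Since 3 divides x + y, either both or none of x and y are multiples of 3.\<close>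

lemma sols_split:
  assumes "finite S"
  defines "A \<equiv> {x \<in> S. \<not> 3 dvd x}" and "B \<equiv> {x \<in> S. 3 dvd x}"
  shows "sols S = sols B + reps B B ((*) 3 ` A) + reps A A ((*) 3 ` S)"
proof -
  have fin: "finite A" "finite B" using assms(1) by (auto simp: A_def B_def)
  have same: "x \<in> A \<longleftrightarrow> y \<in> A" if "x \<in> S" "y \<in> S" "x + y \<in> (*) 3 ` S" for x y
  proof -
    have "3 dvd x + y" using that(3) by auto
    then have "3 dvd x \<longleftrightarrow> 3 dvd y" by presburger
    then show ?thesis using that by (simp add: A_def)
  qed
  have AB: "S = A \<union> B" "A \<inter> B = {}" by (auto simp: A_def B_def)
  let ?P = "\<lambda>X C. {(x, y). x \<in> X \<and> y \<in> X \<and> x + y \<in> (*) 3 ` C}"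
  have "?P S S = (?P B B \<union> ?P B A) \<union> ?P A S"
    using AB same by blast
  moreover have "?P B B \<inter> ?P B A = {}" "(?P B B \<union> ?P B A) \<inter> ?P A S = {}"
    using AB(2) by auto
  moreover have "finite (?P B B)" "finite (?P B A)" "finite (?P A S)"
    by (rule finite_reps_set[OF fin(2) fin(2)] finite_reps_set[OF fin(1) fin(1)])+
  ultimately show ?thesis
    unfolding reps_def by (simp only: card_Un_disjoint finite_Un simp_thms)
qed

text \<open>If 9 divided both x and y, it would divide 3z, making z a multiple of 3. So x or y is
  not divisible by 9, and together with z it determines the pair.\<close>

lemma reps_multiples_le:
  assumes "finite B" "finite A" "\<And>x. x \<in> A \<Longrightarrow> \<not> 3 dvd x"
  shows "reps B B ((*) 3 ` A) \<le> 2 * (card {x \<in> B. \<not> 9 dvd x} * card A)"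
proof -
  define B' where "B' = {x \<in> B. \<not> 9 dvd x}"
  have fin: "finite B'" using assms by (simp add: B'_def)
  have "x \<in> B' \<or> y \<in> B'" if xy: "x \<in> B" "y \<in> B" "x + y \<in> (*) 3 ` A" for x y
  proof (rule ccontr)
    assume "\<not> (x \<in> B' \<or> y \<in> B')"
    then have "9 dvd x + y" using xy by (simp add: B'_def)
    moreover obtain z where "z \<in> A" "x + y = 3 * z" using xy(3) by auto
    ultimately show False using assms(3)[of z] by presburger
  qed
  then have "reps B B ((*) 3 ` A) \<le> card ({(x, y). x \<in> B' \<and> y \<in> B \<and> x + y \<in> (*) 3 ` A}
      \<union> {(x, y). x \<in> B \<and> y \<in> B' \<and> x + y \<in> (*) 3 ` A})"
    unfolding reps_def
    by (intro card_mono finite_UnI finite_reps_set[OF fin assms(1)] finite_reps_set[OF assms(1) fin]) auto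
  also have "\<dots> \<le> reps B' B ((*) 3 ` A) + reps B B' ((*) 3 ` A)"
    unfolding reps_def by (rule card_Un_le)
  also have "\<dots> \<le> card B' * card ((*) 3 ` A) + card B' * card ((*) 3 ` A)"
    using reps_le_prod_left[of B' "(*) 3 ` A" B] reps_le_prod_right[of B' "(*) 3 ` A" B] fin assms(2)
    by simp
  also have "card ((*) 3 ` A) = card A" by (simp add: card_image inj_on_def)
  finally show ?thesis by (simp add: B'_def)
qed

lemma multiples_eq_image:
  assumes "\<And>x. x \<in> S \<Longrightarrow> 3 dvd x"
  shows "S = (*) 3 ` (\<lambda>x. x div (3 :: int)) ` S"
  using assms by (force simp: image_image)

text \<open>Induction on the sum of absolute values. A nonempty set of multiples of 3 without 0 is
  divided by 3; any other nonempty set loses its non-multiples. Both operations lower the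
  sum.\<close>

lemma peel_induct [consumes 2, case_names empty scale peel]:
  fixes S :: "int set"
  assumes "finite S" "0 \<notin> S"
    and "P {}"
    and scale: "\<And>S. finite S \<Longrightarrow> 0 \<notin> S \<Longrightarrow> P S \<Longrightarrow> P ((*) 3 ` S)"
    and peel: "\<And>S. finite S \<Longrightarrow> 0 \<notin> S \<Longrightarrow> P {x \<in> S. 3 dvd x} \<Longrightarrow> P S"
  shows "P S"
  using assms(1,2)
proof (induction "nat (\<Sum>x\<in>S. \<bar>x\<bar>)" arbitrary: S rule: less_induct)
  case less
  consider "S = {}" | "S \<noteq> {}" "\<forall>x\<in>S. 3 dvd x" | x where "x \<in> S" "\<not> 3 dvd x" by blast
  then show ?case
  proof cases
    case 1
    then show ?thesis using assms(3) by simp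
  next
    case 2
    define T where "T = (\<lambda>x. x div 3) ` S"
    have S: "S = (*) 3 ` T" unfolding T_def using 2(2) by (intro multiples_eq_image) simp
    have T: "finite T" "0 \<notin> T" "T \<noteq> {}" using S less.prems 2 by (auto simp: T_def)
    have "(\<Sum>x\<in>S. \<bar>x\<bar>) = 3 * (\<Sum>x\<in>T. \<bar>x\<bar>)"
      unfolding S by (subst sum.reindex) (auto simp: inj_on_def sum_distrib_left abs_mult)
    moreover have "(\<Sum>x\<in>T. \<bar>x\<bar>) > 0" using T by (intro sum_pos) auto
    ultimately have "P T" using T by (intro less.hyps) auto
    then show ?thesis unfolding S using T scale by blast
  next
    case (3 x)
    have "x \<noteq> 0" using 3 by auto
    have "(\<Sum>x\<in>{x \<in> S. 3 dvd x}. \<bar>x\<bar>) < (\<Sum>x\<in>S. \<bar>x\<bar>)"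
      using less.prems 3 \<open>x \<noteq> 0\<close> by (intro sum_strict_mono2[where b = x]) auto
    moreover have "(\<Sum>x\<in>{x \<in> S. 3 dvd x}. \<bar>x\<bar>) \<ge> 0" by (rule sum_nonneg) simp
    ultimately have "nat (\<Sum>x\<in>{x \<in> S. 3 dvd x}. \<bar>x\<bar>) < nat (\<Sum>x\<in>S. \<bar>x\<bar>)" by linarith
    then have "P {x \<in> S. 3 dvd x}" using less.prems by (intro less.hyps) auto
    then show ?thesis using less.prems peel by blast
  qed
qed

lemma card_peel:
  assumes "finite S"
  shows "card S = card {x \<in> S. 3 dvd x} + card {x \<in> S. \<not> 3 dvd (x :: int)}"
proof -
  have "S = {x \<in> S. 3 dvd x} \<union> {x \<in> S. \<not> 3 dvd x}" by auto
  then show ?thesis using assms by (subst card_Un_disjoint[symmetric]) auto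
qed

text \<open>The middle term is left unestimated: the bounds below differ exactly in how they control
  it.\<close>

lemma sols_le_peel:
  assumes "finite S"
  defines "A \<equiv> {x \<in> S. \<not> 3 dvd x}" and "B \<equiv> {x \<in> S. 3 dvd x}"
  shows "real (sols S) \<le> real (sols B) + real (reps B B ((*) 3 ` A)) + real (card A) ^ 2 / 2"
proof -
  have "real (reps A A ((*) 3 ` S)) \<le> real (card A) ^ 2 / 2"
    by (rule reps_nonmultiples_le) (use assms(1) in \<open>auto simp: A_def\<close>)
  then show ?thesis using sols_split[OF assms(1)] by (simp add: A_def B_def)
qed

section \<open>Upper bounds for sets avoiding 0\<close>

text \<open>The middle term is at most nk, by choosing z and one of x, y. The three bounds then add
  up to exactly (n + k)^2 / 2.\<close>

lemma sols_le_half: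
  assumes "finite S" "0 \<notin> S"
  shows "real (sols S) \<le> real (card S) ^ 2 / 2"
  using assms
proof (induction rule: peel_induct)
  case empty
  then show ?case by (simp add: reps_def)
next
  case (scale S)
  then show ?case by (simp add: sols_image_times_3 card_image_times_3)
next
  case (peel S)
  define A B where "A = {x \<in> S. \<not> 3 dvd x}" and "B = {x \<in> S. 3 dvd x}"
  define n k where "n = real (card B)" and "k = real (card A)"
  have N: "real (card S) = n + k" using card_peel[OF peel(1)] by (simp add: A_def B_def n_def k_def)
  have "reps B B ((*) 3 ` A) \<le> card B * card A"
    using reps_le_prod_left[of B "(*) 3 ` A" B] peel(1) by (simp add: A_def B_def card_image_times_3)
  then have "real (reps B B ((*) 3 ` A)) \<le> n * k"
    unfolding n_def k_def by (simp only: of_nat_mult[symmetric] of_nat_le_iff)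
  moreover have "real (sols S) \<le> real (sols B) + real (reps B B ((*) 3 ` A)) + k\<^sup>2 / 2"
    using sols_le_peel[OF peel(1)] by (simp add: A_def B_def k_def)
  moreover have "real (sols B) \<le> n\<^sup>2 / 2" using peel(3) by (simp add: B_def n_def)
  moreover have "(n + k)\<^sup>2 / 2 = n\<^sup>2 / 2 + n * k + k\<^sup>2 / 2" by (simp add: power2_eq_square field_simps)
  ultimately show ?case unfolding N by linarith
qed

text \<open>With n multiples and k non-multiples of 3, a gain appears in each of three ranges. If n
  is tiny, \<open>S\<close> is almost free of multiples of 3. Otherwise the middle term is well
  below nk, by the sumset bound for k \<le> 2n and because it is at most n^2 for k > 2n.\<close>

lemma sols_le_dense_nonmultiples:
  fixes \<nu> :: real
  assumes "\<nu> > 0"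
  shows "\<exists>c. 0 < c \<and> c \<le> 1 / 2 \<and> (\<forall>S. finite S \<longrightarrow> 0 \<notin> S \<longrightarrow>
    real (card {x \<in> S. \<not> 3 dvd x}) \<ge> \<nu> * real (card S) \<longrightarrow>
    real (sols S) \<le> (1 / 2 - c) * real (card S) ^ 2 + 1)"
proof -
  \<comment> \<open>One constant per range: 1/1000 - 3/6000 = 1/2000 for n < N/6000, a gain n^2
    \<ge> (N/6000)^2 for k > 2n, and a gain of k^2 / 4 up to a constant otherwise.\<close>
  define c :: real where "c = min (1 / 2000) (min ((1 / 6000)\<^sup>2) (\<nu>\<^sup>2 / 4))"
  have c: "0 < c" "c \<le> 1 / 2000" "c \<le> (1 / 6000)\<^sup>2" "c \<le> \<nu>\<^sup>2 / 4"
    using assms by (auto simp: c_def)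
  have "real (sols S) \<le> (1 / 2 - c) * real (card S) ^ 2 + 1"
    if S: "finite S" "0 \<notin> S" and dense: "real (card {x \<in> S. \<not> 3 dvd x}) \<ge> \<nu> * real (card S)" for S
  proof -
    define A B where "A = {x \<in> S. \<not> 3 dvd x}" and "B = {x \<in> S. 3 dvd x}"
    define n k N where "n = real (card B)" and "k = real (card A)" and "N = real (card S)"
    have fin: "finite A" "finite B" using S by (auto simp: A_def B_def)
    have N: "N = n + k" using card_peel[OF S(1)] by (simp add: A_def B_def n_def k_def N_def)
    have nonneg: "n \<ge> 0" "k \<ge> 0" "N \<ge> 0" by (auto simp: n_def k_def N_def)
    have cN: "c * N\<^sup>2 \<le> 1 / 2000 * N\<^sup>2" "c * N\<^sup>2 \<le> (1 / 6000)\<^sup>2 * N\<^sup>2" "c * N\<^sup>2 \<le> \<nu>\<^sup>2 / 4 * N\<^sup>2"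
      by (rule mult_right_mono; use c in simp)+
    have goal: "?thesis \<longleftrightarrow> real (sols S) \<le> N\<^sup>2 / 2 - c * N\<^sup>2 + 1"
      by (simp add: N_def algebra_simps)
    show ?thesis
    proof (cases "n < N / 6000")
      case True
      have "S - A = B" "A \<subseteq> S" by (auto simp: A_def B_def)
      then have "sols S \<le> sols A + 3 * card B * card S"
        using sols_le_subset[OF S(1), of A] by simp
      then have "real (sols S) \<le> real (sols A + 3 * card B * card S)" by (simp only: of_nat_le_iff)
      then have "real (sols S) \<le> real (sols A) + 3 * (n * N)" by (simp add: n_def N_def)
      moreover have "n * N \<le> N / 6000 * N" using True nonneg by (intro mult_right_mono) auto
      moreover have "real (sols A) \<le> (1 / 2 - 1 / 1000) * k\<^sup>2 + 1 / 2"
        unfolding k_def by (rule sols_nonmultiples_le) (use fin in \<open>auto simp: A_def\<close>)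
      moreover have "k\<^sup>2 \<le> N\<^sup>2" using N nonneg by (intro power_mono) auto
      ultimately show ?thesis unfolding goal using cN(1) by (simp add: power2_eq_square)
    next
      case False
      have "real (sols B) \<le> n\<^sup>2 / 2"
        unfolding n_def by (rule sols_le_half) (use fin S in \<open>auto simp: B_def\<close>)
      moreover have "real (sols S) \<le> real (sols B) + real (reps B B ((*) 3 ` A)) + k\<^sup>2 / 2"
        using sols_le_peel[OF S(1)] by (simp add: A_def B_def k_def)
      moreover have "N\<^sup>2 / 2 = n\<^sup>2 / 2 + n * k + k\<^sup>2 / 2"
        unfolding N by (simp add: power2_eq_square field_simps)
      moreover have "real (reps B B ((*) 3 ` A)) \<le> n * k - c * N\<^sup>2 + 1 / 4"
      proof (cases "k \<le> 2 * n")
        case True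
        define bad where "bad = card {(x, y). x \<in> B \<and> y \<in> B \<and> x + y \<notin> (*) 3 ` A}"
        have "card A \<le> 2 * card B" using True by (simp add: k_def n_def)
        then have "(int (card B) + int (card B) - int (card A))\<^sup>2 \<le> 1 + 4 * int bad"
          unfolding bad_def using fin by (intro nonreps_lower_bound) (auto simp: card_image_times_3)
        then have "real_of_int ((int (card B) + int (card B) - int (card A))\<^sup>2) \<le> real_of_int (1 + 4 * int bad)"
          by (simp only: of_int_le_iff)
        then have "(n + n - k)\<^sup>2 \<le> 1 + 4 * real bad" by (simp add: n_def k_def)
        moreover have "real (reps B B ((*) 3 ` A)) + real bad = n * n"
          using arg_cong[OF reps_plus_nonreps[OF fin(2) fin(2), of "(*) 3 ` A"], of real]
          unfolding bad_def n_def by (simp only: of_nat_add of_nat_mult)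
        \<comment> \<open>Up to 1/4 the first term on the right is a lower bound for
          \<open>bad\<close>, which leaves nk - k^2 / 4 for the good pairs.\<close>
        moreover have "n * n = (n + n - k)\<^sup>2 / 4 + n * k - k\<^sup>2 / 4"
          by (simp add: power2_eq_square field_simps)
        moreover have "(\<nu> * N)\<^sup>2 \<le> k\<^sup>2"
          using dense assms nonneg by (intro power_mono) (auto simp: A_def k_def N_def)
        ultimately show ?thesis using cN(3) by (simp add: power_mult_distrib)
      next
        case False
        have "reps B B ((*) 3 ` A) \<le> card B * card B" by (rule reps_le_prod[OF fin(2) fin(2)])
        then have "real (reps B B ((*) 3 ` A)) \<le> n * n"
          unfolding n_def by (simp only: of_nat_mult[symmetric] of_nat_le_iff)
        \<comment> \<open>Hence n^2 = 2n^2 - n^2 \<le> nk - n^2.\<close>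
        moreover have "n * (2 * n) \<le> n * k" using False nonneg by (intro mult_left_mono) auto
        moreover have "(N / 6000) * (N / 6000) \<le> n * n"
          using \<open>\<not> n < N / 6000\<close> nonneg by (intro mult_mono) auto
        ultimately show ?thesis using cN(2) by (simp add: power2_eq_square)
      qed
      ultimately show ?thesis unfolding goal by linarith
    qed
  qed
  then show ?thesis using c by (intro exI[of _ c]) auto
qed

text \<open>Only the third case below uses the induction hypothesis, and it passes the additive 1 on
  unchanged, so that this error does not accumulate over the peeling steps.\<close>

lemma sols_upper_bound:
  "\<exists>\<delta>. 0 < \<delta> \<and> (\<forall>S. finite S \<longrightarrow> 0 \<notin> S \<longrightarrow>
    real (sols S) \<le> (1 / 2 - \<delta>) * real (card S) ^ 2 + 1)"
proof -
  obtain c\<^sub>1 :: real where c\<^sub>1: "0 < c\<^sub>1" "c\<^sub>1 \<le> 1 / 2"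
    "\<And>S. finite S \<Longrightarrow> 0 \<notin> S \<Longrightarrow> real (card {x \<in> S. \<not> 3 dvd x}) \<ge> 1 / 4 * real (card S)
      \<Longrightarrow> real (sols S) \<le> (1 / 2 - c\<^sub>1) * real (card S) ^ 2 + 1"
    using sols_le_dense_nonmultiples[of "1 / 4"] by auto
  \<comment> \<open>Discarding fewer than \<nu> N elements costs at most 3 \<nu> N^2 solutions, half
    of the gain \<open>c\<^sub>1\<close>.\<close>
  define \<nu> where "\<nu> = c\<^sub>1 / 6"
  have \<nu>: "0 < \<nu>" "\<nu> \<le> 1 / 12" using c\<^sub>1 by (auto simp: \<nu>_def)
  obtain c\<^sub>2 :: real where c\<^sub>2: "0 < c\<^sub>2"
    "\<And>S. finite S \<Longrightarrow> 0 \<notin> S \<Longrightarrow> real (card {x \<in> S. \<not> 3 dvd x}) \<ge> \<nu> * real (card S)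
      \<Longrightarrow> real (sols S) \<le> (1 / 2 - c\<^sub>2) * real (card S) ^ 2 + 1"
    using sols_le_dense_nonmultiples[OF \<nu>(1)] by auto
  \<comment> \<open>The three terms serve cases 2, 1 and 3 below, in this order.\<close>
  define \<delta> where "\<delta> = min (c\<^sub>1 / 2) (min c\<^sub>2 (1 / 10))"
  have \<delta>: "0 < \<delta>" "\<delta> \<le> c\<^sub>1 / 2" "\<delta> \<le> c\<^sub>2" "\<delta> \<le> 1 / 10" using c\<^sub>1 c\<^sub>2 by (auto simp: \<delta>_def)
  have "real (sols S) \<le> (1 / 2 - \<delta>) * real (card S) ^ 2 + 1" if "finite S" "0 \<notin> S" for S
    using that
  proof (induction rule: peel_induct)
    case empty
    then show ?case by (simp add: reps_def)
  next
    case (scale S)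
    then show ?case by (simp add: sols_image_times_3 card_image_times_3)
  next
    case (peel S)
    define A B where "A = {x \<in> S. \<not> 3 dvd x}" and "B = {x \<in> S. 3 dvd x}"
    define n k N where "n = real (card B)" and "k = real (card A)" and "N = real (card S)"
    have fin: "finite A" "finite B" using peel(1) by (auto simp: A_def B_def)
    have N: "N = n + k" using card_peel[OF peel(1)] by (simp add: A_def B_def n_def k_def N_def)
    have nonneg: "n \<ge> 0" "k \<ge> 0" "N \<ge> 0" by (auto simp: n_def k_def N_def)
    have \<delta>N: "\<delta> * N\<^sup>2 \<le> c\<^sub>1 / 2 * N\<^sup>2" "\<delta> * N\<^sup>2 \<le> c\<^sub>2 * N\<^sup>2"
      by (rule mult_right_mono; use \<delta> in simp)+
    have goal: "?case \<longleftrightarrow> real (sols S) \<le> N\<^sup>2 / 2 - \<delta> * N\<^sup>2 + 1"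
      by (simp add: N_def algebra_simps)
    \<comment> \<open>These elements of \<open>B\<close> are divisible by 3 exactly once, so they
      become the non-multiples of 3 in \<open>B\<close> / 3. If there are many, the bound with
      threshold 1/4 applies to \<open>B\<close> / 3; if there are few, the middle term is
      small.\<close>
    define k\<^sub>1 where "k\<^sub>1 = card {x \<in> B. \<not> 9 dvd x}"
    consider "k \<ge> \<nu> * N" | "k < \<nu> * N" "real k\<^sub>1 \<ge> 1 / 4 * n" | "k < \<nu> * N" "real k\<^sub>1 < 1 / 4 * n"
      by fastforce
    then show ?case
    proof cases
      case 1
      then have "real (sols S) \<le> (1 / 2 - c\<^sub>2) * N\<^sup>2 + 1"
        unfolding N_def by (intro c\<^sub>2(2) peel) (simp add: k_def A_def)
      then show ?thesis unfolding goal using \<delta>N(2) by (simp add: algebra_simps)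
    next
      case 2
      define T where "T = (\<lambda>x. x div 3) ` B"
      have B: "B = (*) 3 ` T" unfolding T_def by (intro multiples_eq_image) (simp add: B_def)
      have T: "finite T" "0 \<notin> T" using B fin peel(2) by (auto simp: T_def B_def)
      have "{x \<in> B. \<not> 9 dvd x} = (*) 3 ` {x \<in> T. \<not> 3 dvd x}"
      proof -
        have "9 dvd 3 * x \<longleftrightarrow> 3 dvd x" for x :: int by presburger
        then show ?thesis unfolding B by auto
      qed
      then have "k\<^sub>1 = card {x \<in> T. \<not> 3 dvd x}" by (simp add: k\<^sub>1_def card_image_times_3)
      moreover have nT: "n = real (card T)" by (simp add: n_def B card_image_times_3)
      ultimately have "real (sols T) \<le> (1 / 2 - c\<^sub>1) * n\<^sup>2 + 1"
        using 2(2) T by (simp add: c\<^sub>1(3))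
      then have "real (sols B) \<le> (1 / 2 - c\<^sub>1) * n\<^sup>2 + 1"
        unfolding B sols_image_times_3 .
      moreover have "(1 / 2 - c\<^sub>1) * n\<^sup>2 \<le> (1 / 2 - c\<^sub>1) * N\<^sup>2"
        using c\<^sub>1 N nonneg by (intro mult_left_mono power_mono) auto
      moreover have "real (sols S) \<le> real (sols B) + 3 * (k * N)"
      proof -
        have "S - B = A" "B \<subseteq> S" by (auto simp: A_def B_def)
        then have "sols S \<le> sols B + 3 * card A * card S"
          using sols_le_subset[OF peel(1), of B] by simp
        then have "real (sols S) \<le> real (sols B + 3 * card A * card S)" by (simp only: of_nat_le_iff)
        then show ?thesis by (simp add: k_def N_def)
      qed
      moreover have "k * N \<le> (\<nu> * N) * N" using 2(1) nonneg by (intro mult_right_mono) auto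
      moreover have "3 * ((\<nu> * N) * N) = c\<^sub>1 / 2 * N\<^sup>2" by (simp add: \<nu>_def power2_eq_square)
      moreover have "(1 / 2 - c\<^sub>1) * N\<^sup>2 = N\<^sup>2 / 2 - c\<^sub>1 / 2 * N\<^sup>2 - c\<^sub>1 / 2 * N\<^sup>2"
        by (simp add: field_simps)
      ultimately show ?thesis unfolding goal using \<delta>N(1) by linarith
    next
      case 3
      have "\<nu> * N \<le> 1 / 12 * N" using \<nu> nonneg by (intro mult_right_mono) auto
      then have "k \<le> n" using 3(1) N nonneg by linarith
      have "reps B B ((*) 3 ` A) \<le> 2 * (k\<^sub>1 * card A)"
        unfolding k\<^sub>1_def using fin by (intro reps_multiples_le) (auto simp: A_def)
      then have "real (reps B B ((*) 3 ` A)) \<le> real (2 * (k\<^sub>1 * card A))"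
        by (simp only: of_nat_le_iff)
      then have "real (reps B B ((*) 3 ` A)) \<le> 2 * (real k\<^sub>1 * k)" by (simp add: k_def)
      \<comment> \<open>The middle term is thus at most nk / 2, half of the trivial bound. The saved
        nk / 2 pays for the growth \<delta> (2nk + k^2) from \<delta> n^2 to \<delta> N^2.\<close>
      moreover have "real k\<^sub>1 * k \<le> (1 / 4 * n) * k" using 3(2) nonneg by (intro mult_right_mono) auto
      moreover have "real (sols S) \<le> real (sols B) + real (reps B B ((*) 3 ` A)) + k\<^sup>2 / 2"
        using sols_le_peel[OF peel(1)] by (simp add: A_def B_def k_def)
      moreover have "real (sols B) \<le> (1 / 2 - \<delta>) * n\<^sup>2 + 1" using peel(3) by (simp add: B_def n_def)
      moreover have "N\<^sup>2 / 2 - \<delta> * N\<^sup>2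
          = (1 / 2 - \<delta>) * n\<^sup>2 + 1 / 2 * (n * k) + k\<^sup>2 / 2 + k * ((1 / 2 - 2 * \<delta>) * n - \<delta> * k)"
        unfolding N by (simp add: power2_eq_square field_simps)
      moreover have "k * ((1 / 2 - 2 * \<delta>) * n - \<delta> * k) \<ge> 0"
      proof -
        have "\<delta> * k \<le> 1 / 10 * n" using \<delta> \<open>k \<le> n\<close> nonneg by (intro mult_mono) auto
        also have "\<dots> \<le> (1 / 2 - 2 * \<delta>) * n" using \<delta> nonneg by (intro mult_right_mono) auto
        finally show ?thesis using nonneg by simp
      qed
      ultimately show ?thesis unfolding goal by simp
    qed
  qed
  then show ?thesis using \<delta>(1) by blast
qed

subsection \<open>Many solutions\<close>

text \<open>Counts pairs grouped by their sum when the group sizes form an arithmetic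
  progression.\<close>

lemma card_Sigma_linear:
  fixes U :: "nat \<Rightarrow> int set" and c d :: real
  assumes "\<And>j. j \<in> {1..n} \<Longrightarrow> finite (U j)"
    and "\<And>j. j \<in> {1..n} \<Longrightarrow> real (card (U j)) = c - d * real j"
  shows "real (card (Sigma {1..n} U)) = c * real n - d * (real n * (real n + 1) / 2)"
proof -
  have "real (card (Sigma {1..n} U)) = (\<Sum>j\<in>{1..n}. c - d * real j)"
    using assms by (subst card_SigmaI) auto
  also have "\<dots> = c * real n - d * (\<Sum>j\<in>{1..n}. real j)"
    by (simp add: sum_subtractf sum_distrib_left)
  also have "(\<Sum>j\<in>{1..n}. real j) = real n * (real n + 1) / 2"
    by (induction n) (simp_all add: field_simps)
  finally show ?thesis .
qed

section \<open>An explicit family of sets with many solutions\<close>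

definition witness_set :: "nat \<Rightarrow> int set" where
  "witness_set m = {- 6 * int m..6 * int m} \<union> (*) 3 ` {- 9 * int m..9 * int m}"

lemma finite_witness_set: "finite (witness_set m)"
  by (simp add: witness_set_def)

lemma card_witness_set: "card (witness_set m) = 26 * m + 1"
proof -
  have "{- 6 * int m..6 * int m} \<inter> (*) 3 ` {- 9 * int m..9 * int m} = (*) 3 ` {- 2 * int m..2 * int m}"
    by auto
  then have "card (witness_set m) + card {- 2 * int m..2 * int m}
      = card {- 6 * int m..6 * int m} + card {- 9 * int m..9 * int m}"
    using card_Un_Int[of "{- 6 * int m..6 * int m}" "(*) 3 ` {- 9 * int m..9 * int m}"]
    by (simp only: witness_set_def finite_atLeastAtMost_int finite_imageI card_image_times_3)
  then show ?thesis by simp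
qed

lemma witness_set_uminus: "- x \<in> witness_set m \<longleftrightarrow> x \<in> witness_set m"
proof -
  have "- x \<in> witness_set m" if x: "x \<in> witness_set m" for x
  proof (cases "x \<in> {- 6 * int m..6 * int m}")
    case True
    then show ?thesis by (simp add: witness_set_def)
  next
    case False
    then obtain u where "u \<in> {- 9 * int m..9 * int m}" "x = 3 * u"
      using x by (auto simp: witness_set_def)
    then have "- x = 3 * (- u)" "- u \<in> {- 9 * int m..9 * int m}" by auto
    then show ?thesis unfolding witness_set_def by blast
  qed
  from this[of x] this[of "- x"] show ?thesis by auto
qed

text \<open>Solutions with z > 0 are listed in four disjoint families and doubled by the symmetry
  under negation; those with z = 0 are dropped, being of lower order. Since 260 / 26^2 = 5/13, this
  gives the required density.\<close>

lemma sols_witness_set: "260 * real m ^ 2 - 6 * real m \<le> real (sols (witness_set m))"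
proof -
  define S where "S = witness_set m"
  define G where "G = {(x, y). x \<in> S \<and> y \<in> S \<and> x + y \<in> (*) 3 ` S \<and> x + y > 0}"
  define G' where "G' = {(x, y). x \<in> S \<and> y \<in> S \<and> x + y \<in> (*) 3 ` S \<and> x + y < 0}"
  have fin: "finite S" by (simp add: S_def finite_witness_set)
  have finG: "finite G" "finite G'"
    unfolding G_def G'_def by (rule finite_reps_set[OF fin fin])+
  have uminus: "- x \<in> S \<longleftrightarrow> x \<in> S" for x by (simp add: S_def witness_set_uminus)
  have uminus3: "- x \<in> (*) 3 ` S" if x: "x \<in> (*) 3 ` S" for x
  proof -
    obtain z where "z \<in> S" "x = 3 * z" using x by auto
    then have "- z \<in> S" "- x = 3 * (- z)" by (auto simp: uminus)
    then show ?thesis by blast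
  qed
  have "card G \<le> card G'"
  proof (rule card_inj_on_le[where f = "\<lambda>(x, y). (- x, - y)"])
    show "(\<lambda>(x, y). (- x, - y)) ` G \<subseteq> G'"
    proof clarify
      fix x y assume "(x, y) \<in> G"
      then have "x \<in> S" "y \<in> S" "x + y \<in> (*) 3 ` S" "x + y > 0" by (auto simp: G_def)
      moreover have "- x + - y = - (x + y)" by simp
      then have "- x + - y \<in> (*) 3 ` S" using uminus3 calculation(3) by (simp only:)
      ultimately show "(- x, - y) \<in> G'" unfolding G'_def mem_Collect_eq prod.case uminus by linarith
    qed
  qed (auto simp: inj_on_def finG)
  moreover have "card G + card G' \<le> sols S"
  proof -
    have "card G + card G' = card (G \<union> G')"
      using finG by (intro card_Un_disjoint[symmetric]) (auto simp: G_def G'_def)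
    also have "\<dots> \<le> sols S"
      unfolding reps_def by (intro card_mono finite_reps_set[OF fin fin]) (auto simp: G_def G'_def)
    finally show ?thesis .
  qed
  ultimately have two: "2 * real (card G) \<le> real (sols S)" by linarith
  \<comment> \<open>The index j encodes z and the second component encodes x. In \<open>F1\<close>
    and \<open>F2\<close>, x and y are multiples of 3, with z = j \<le> 6m and z = 3(2m + j) \<le>
    18m; 18m is the largest possible z, as x + y \<le> 54m. In \<open>F3\<close> and
    \<open>F4\<close>, x is 1 or 2 modulo 3, and x, y stay within [-6m, 6m], so z = j \<le>
    4m.\<close>
  define U1 where "U1 = (\<lambda>j. {int j - 9 * int m..9 * int m})"
  define U2 where "U2 = (\<lambda>j. {3 * (2 * int m + int j) - 9 * int m..9 * int m})"
  define U3 where "U3 = (\<lambda>j. {int j - 2 * int m..2 * int m - 1})"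
  define f1 :: "nat \<times> int \<Rightarrow> int \<times> int" where "f1 = (\<lambda>(j, u). (3 * u, 3 * int j - 3 * u))"
  define f2 :: "nat \<times> int \<Rightarrow> int \<times> int" where "f2 = (\<lambda>(j, u). (3 * u, 9 * (2 * int m + int j) - 3 * u))"
  define f3 :: "nat \<times> int \<Rightarrow> int \<times> int" where "f3 = (\<lambda>(j, v). (3 * v + 1, 3 * int j - 3 * v - 1))"
  define f4 :: "nat \<times> int \<Rightarrow> int \<times> int" where "f4 = (\<lambda>(j, v). (3 * v + 2, 3 * int j - 3 * v - 2))"
  define F1 where "F1 = f1 ` Sigma {1..6 * m} U1"
  define F2 where "F2 = f2 ` Sigma {1..4 * m} U2"
  define F3 where "F3 = f3 ` Sigma {1..4 * m} U3"
  define F4 where "F4 = f4 ` Sigma {1..4 * m} U3"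
  have c1: "real (card F1) = 90 * real m ^ 2 + 3 * real m"
  proof -
    have "card F1 = card (Sigma {1..6 * m} U1)"
      unfolding F1_def by (rule card_image) (auto simp: f1_def inj_on_def)
    also have "real \<dots> = (18 * real m + 1) * real (6 * m) - 1 * (real (6 * m) * (real (6 * m) + 1) / 2)"
      by (rule card_Sigma_linear) (auto simp: U1_def of_nat_diff)
    finally show ?thesis by (simp add: power2_eq_square field_simps)
  qed
  have c2: "real (card F2) = 24 * real m ^ 2 - 2 * real m"
  proof -
    have "card F2 = card (Sigma {1..4 * m} U2)"
      unfolding F2_def by (rule card_image) (auto simp: f2_def inj_on_def)
    also have "real \<dots> = (12 * real m + 1) * real (4 * m) - 3 * (real (4 * m) * (real (4 * m) + 1) / 2)"
      by (rule card_Sigma_linear) (auto simp: U2_def of_nat_diff)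
    finally show ?thesis by (simp add: power2_eq_square field_simps)
  qed
  have c34: "real (card (Sigma {1..4 * m} U3)) = 8 * real m ^ 2 - 2 * real m"
  proof -
    have "real (card (Sigma {1..4 * m} U3)) = 4 * real m * real (4 * m) - 1 * (real (4 * m) * (real (4 * m) + 1) / 2)"
      by (rule card_Sigma_linear) (auto simp: U3_def of_nat_diff)
    then show ?thesis by (simp add: power2_eq_square field_simps)
  qed
  have c3: "card F3 = card (Sigma {1..4 * m} U3)"
    unfolding F3_def by (rule card_image) (auto simp: f3_def inj_on_def)
  have c4: "card F4 = card (Sigma {1..4 * m} U3)"
    unfolding F4_def by (rule card_image) (auto simp: f4_def inj_on_def)
  have small: "x \<in> S" if "- 6 * int m \<le> x" "x \<le> 6 * int m" for x
    using that by (simp add: S_def witness_set_def)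
  have mult: "3 * u \<in> S" if "- 9 * int m \<le> u" "u \<le> 9 * int m" for u
    using that by (simp add: S_def witness_set_def)
  have G: "(x, y) \<in> G" if "x \<in> S" "y \<in> S" "z \<in> S" "x + y = 3 * z" "z > 0" for x y z
    using that by (auto simp: G_def)
  have "F1 \<subseteq> G"
  proof
    fix p assume "p \<in> F1"
    then obtain j u where j: "1 \<le> j" "j \<le> 6 * m" "int j - 9 * int m \<le> u" "u \<le> 9 * int m"
      and p: "p = (3 * u, 3 * (int j - u))"
      by (auto simp: F1_def f1_def U1_def right_diff_distrib)
    show "p \<in> G" unfolding p
      by (rule G[where z = "int j", OF mult mult small]) (use j in auto)
  qed
  moreover have "F2 \<subseteq> G"
  proof
    fix p assume "p \<in> F2"
    then obtain j u where j: "1 \<le> j" "j \<le> 4 * m" "3 * (2 * int m + int j) - 9 * int m \<le> u" "u \<le> 9 * int m"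
      and p: "p = (3 * u, 3 * (3 * (2 * int m + int j) - u))"
      by (auto simp: F2_def f2_def U2_def right_diff_distrib)
    show "p \<in> G" unfolding p
      by (rule G[where z = "3 * (2 * int m + int j)", OF mult mult mult]) (use j in auto)
  qed
  moreover have "F3 \<subseteq> G"
  proof
    fix p assume "p \<in> F3"
    then obtain j v where j: "1 \<le> j" "j \<le> 4 * m" "int j - 2 * int m \<le> v" "v \<le> 2 * int m - 1"
      and p: "p = (3 * v + 1, 3 * int j - 3 * v - 1)"
      by (auto simp: F3_def f3_def U3_def)
    show "p \<in> G" unfolding p
      by (rule G[where z = "int j", OF small small small]) (use j in auto)
  qed
  moreover have "F4 \<subseteq> G"
  proof
    fix p assume "p \<in> F4"
    then obtain j v where j: "1 \<le> j" "j \<le> 4 * m" "int j - 2 * int m \<le> v" "v \<le> 2 * int m - 1"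
      and p: "p = (3 * v + 2, 3 * int j - 3 * v - 2)"
      by (auto simp: F4_def f4_def U3_def)
    show "p \<in> G" unfolding p
      by (rule G[where z = "int j", OF small small small]) (use j in auto)
  qed
  ultimately have "card (F1 \<union> F2 \<union> F3 \<union> F4) \<le> card G"
    using finG by (intro card_mono) auto
  moreover have "card (F1 \<union> F2 \<union> F3 \<union> F4) = card F1 + card F2 + card F3 + card F4"
  proof -
    have class0: "fst p mod 3 = 0" if "p \<in> F1 \<union> F2" for p
      using that by (auto simp: F1_def f1_def F2_def f2_def)
    have class3: "fst p mod 3 = 1" if "p \<in> F3" for p
      using that by (auto simp: F3_def f3_def)
    have class4: "fst p mod 3 = 2" if "p \<in> F4" for p
      using that by (auto simp: F4_def f4_def)
    \<comment> \<open>The value 18m of x + y, that is z = 6m, separates the two families of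
      multiples of 3.\<close>
    have "fst p + snd p \<le> 18 * int m" if "p \<in> F1" for p
      using that by (auto simp: F1_def f1_def)
    moreover have "fst p + snd p > 18 * int m" if "p \<in> F2" for p
      using that by (auto simp: F2_def f2_def)
    ultimately have "F1 \<inter> F2 = {}" by force
    moreover have "(F1 \<union> F2) \<inter> F3 = {}" "(F1 \<union> F2 \<union> F3) \<inter> F4 = {}"
      using class0 class3 class4 by force+
    moreover have "finite F1" "finite F2" "finite F3" "finite F4"
      by (auto simp: F1_def F2_def F3_def F4_def U1_def U2_def U3_def)
    ultimately show ?thesis by (simp only: card_Un_disjoint finite_Un simp_thms)
  qed
  ultimately have "real (card F1) + real (card F2) + real (card F3) + real (card F4) \<le> real (card G)"
    by linarith
  then show ?thesis using two c1 c2 c3 c4 c34 by (simp add: S_def)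
qed

subsection \<open>The density\<close>

text \<open>The witnesses only have sizes 26m + 1, but the limsup along a subsequence is a lower
  bound for the full one.\<close>

lemma solution_density_ge: "ereal (5 / 13) \<le> solution_density 1 1 (-3)"
proof -
  define M where "M = (\<lambda>N::nat. SUP S \<in> {S :: int set. finite S \<and> card S = N}.
    ereal (real (solution_count 1 1 (-3) S) / real N ^ 2))"
  define r where "r = (\<lambda>m::nat. 26 * m + 1)"
  define g where "g = (\<lambda>m. (260 * real m ^ 2 - 6 * real m) / (1 + 26 * real m) ^ 2)"
  have "g \<longlonglongrightarrow> 5 / 13" unfolding g_def by real_asymp
  then have "(\<lambda>m. ereal (g m)) \<longlonglongrightarrow> ereal (5 / 13)" by simp
  then have "ereal (5 / 13) = limsup (\<lambda>m. ereal (g m))"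
    by (rule lim_imp_Limsup[symmetric, OF sequentially_bot])
  also have "\<dots> \<le> limsup (M \<circ> r)"
  proof (rule Limsup_mono, rule always_eventually, rule allI)
    fix m
    have "ereal (g m) \<le> ereal (real (solution_count 1 1 (-3) (witness_set m)) / real (r m) ^ 2)"
      using sols_witness_set[of m]
      by (simp add: g_def r_def solution_count_eq_sols divide_right_mono)
    also have "\<dots> \<le> M (r m)"
      unfolding M_def by (rule SUP_upper) (simp add: finite_witness_set card_witness_set r_def)
    finally show "ereal (g m) \<le> (M \<circ> r) m" by simp
  qed
  also have "\<dots> \<le> limsup M"
    by (rule limsup_subseq_mono) (simp add: strict_mono_def r_def)
  finally show ?thesis by (simp add: solution_density_def M_def)
qed

lemma solution_density_le:
  "\<exists>\<delta>. 0 < \<delta> \<and> solution_density 1 1 (-3) \<le> ereal (1 / 2 - \<delta>)"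
proof -
  obtain \<delta> where \<delta>: "0 < \<delta>" "\<And>S. finite S \<Longrightarrow> 0 \<notin> S \<Longrightarrow>
      real (sols S) \<le> (1 / 2 - \<delta>) * real (card S) ^ 2 + 1"
    using sols_upper_bound by blast
  \<comment> \<open>Capping at 1/2 keeps the coefficient 1/2 - \<epsilon> nonnegative, so that |S -
    {0}| may be replaced by the larger N.\<close>
  define \<epsilon> where "\<epsilon> = min \<delta> (1 / 2)"
  have \<epsilon>: "0 < \<epsilon>" "\<epsilon> \<le> \<delta>" "\<epsilon> \<le> 1 / 2" using \<delta>(1) by (auto simp: \<epsilon>_def)
  have bound: "real (sols S) \<le> (1 / 2 - \<epsilon>) * real N ^ 2 + 1 + 3 * real N"
    if S: "finite S" "card S = N" for S N
  proof -
    have le: "card (S - {0}) \<le> N" and "card (S - (S - {0})) \<le> 1"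
      using S card_mono[of S "S - {0}"] card_mono[of "{0}" "S - (S - {0})"] by auto
    then have "3 * card (S - (S - {0})) * card S \<le> 3 * N"
      using S(2) by simp
    then have "sols S \<le> sols (S - {0}) + 3 * N"
      using sols_le_subset[OF S(1), of "S - {0}"] by simp
    then have "real (sols S) \<le> real (sols (S - {0}) + 3 * N)" by (simp only: of_nat_le_iff)
    moreover have "real (sols (S - {0})) \<le> (1 / 2 - \<delta>) * real (card (S - {0})) ^ 2 + 1"
      using S(1) by (intro \<delta>(2)) auto
    moreover have "(1 / 2 - \<delta>) * real (card (S - {0})) ^ 2 \<le> (1 / 2 - \<epsilon>) * real (card (S - {0})) ^ 2"
      using \<epsilon> by (intro mult_right_mono) auto
    moreover have "(1 / 2 - \<epsilon>) * real (card (S - {0})) ^ 2 \<le> (1 / 2 - \<epsilon>) * real N ^ 2"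
      using \<epsilon> le by (intro mult_left_mono power_mono) auto
    ultimately show ?thesis by simp
  qed
  \<comment> \<open>The additive 1 and the at most 3N solutions involving 0 are absorbed by half of
    \<epsilon>.\<close>
  have "(\<lambda>N. (1 + 3 * real N) / real N ^ 2) \<longlonglongrightarrow> 0" by real_asymp
  then have "eventually (\<lambda>N. (1 + 3 * real N) / real N ^ 2 < \<epsilon> / 2) sequentially"
    using \<epsilon>(1) by (intro order_tendstoD) auto
  then have "eventually (\<lambda>N. (SUP S \<in> {S :: int set. finite S \<and> card S = N}.
      ereal (real (solution_count 1 1 (-3) S) / real N ^ 2)) \<le> ereal (1 / 2 - \<epsilon> / 2)) sequentially"
    using eventually_gt_at_top[of 0]
  proof eventually_elim
    case (elim N)
    show ?case
    proof (rule SUP_least)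
      fix S :: "int set" assume "S \<in> {S. finite S \<and> card S = N}"
      then have "real (sols S) / real N ^ 2 \<le> ((1 / 2 - \<epsilon>) * real N ^ 2 + 1 + 3 * real N) / real N ^ 2"
        by (intro divide_right_mono bound) auto
      also have "\<dots> = 1 / 2 - \<epsilon> + (1 + 3 * real N) / real N ^ 2"
        using elim(2) by (simp add: add_divide_distrib)
      also have "\<dots> \<le> 1 / 2 - \<epsilon> / 2" using elim(1) by linarith
      finally show "ereal (real (solution_count 1 1 (-3) S) / real N ^ 2) \<le> ereal (1 / 2 - \<epsilon> / 2)"
        by (simp add: solution_count_eq_sols)
    qed
  qed
  then have "solution_density 1 1 (-3) \<le> ereal (1 / 2 - \<epsilon> / 2)"
    unfolding solution_density_def by (rule Limsup_bounded)
  then show ?thesis using \<epsilon>(1) by (intro exI[of _ "\<epsilon> / 2"]) simp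
qed

theorem theorem1p1:
  shows "\<exists>\<delta>::real. \<delta> > 0 \<and>
    ereal (5 / 13) \<le> solution_density 1 1 (-3) \<and>
    solution_density 1 1 (-3) \<le> ereal (1 / 2 - \<delta>)"
  using solution_density_ge solution_density_le by blast

end
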